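(* Given positive weights $\{\omega_j\}_{j=1}^n$, if $\{V_j\}_{j=1}^n\subset\mathcal{G}_d$ and $m=\sum_{j=1}^n\omega_j\dim(V_j)$, then the following points hold. 1) For $1\le p<\infty$, $$\operatorname{FFP}(\{(V_j,\omega_j)\}_{j=1}^n,p)\;\ge\;\frac{\Big(\frac{m^2}{d}-\sum_{j=1}^n\omega_j^2\dim(V_j)\Big)^p}{\Big(\sum_{i\ne j}\omega_i\omega_j\Big)^{p-1}}+\sum_{j=1}^n\omega_j^2\dim(V_j)^p .$$ If $p=1$, then equality holds if and only if $\{(V_j,\omega_j)\}_{j=1}^n$ is a tight fusion frame. If $1<p<\infty$, then equality holds if and only if $\{(V_j,\omega_j)\}_{j=1}^n$ is an equiangular tight fusion frame. 2) $$\max_{i\ne j}\langle P_{V_i},P_{V_j}\rangle\;\ge\;\frac{\frac{m^2}{d}-\sum_{j=1}^n\omega_j^2\dim(V_j)}{\sum_{i\ne j}\omega_i\omega_j}.$$ Equality holds if and only if $\{(V_j,\omega_j)\}_{j=1}^n$ is an equiangular tight fusion frame.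
   Context: $\mathcal{G}_d$ denotes the set of all linear subspaces $V$ of $\mathbb{R}^d$ with $1\le\dim(V)\le d-1$ (the union of the real Grassmann spaces $\mathcal{G}_{k,d}$ of $k$-dimensional subspaces of $\mathbb{R}^d$, $k=1,\dots,d-1$). For a linear subspace $V\subset\mathbb{R}^d$, $P_V$ denotes the orthogonal projection of $\mathbb{R}^d$ onto $V$, and $\langle P,Q\rangle:=\operatorname{trace}(PQ)$ for self-adjoint operators $P,Q$ on $\mathbb{R}^d$. Sums over $i\ne j$ run over ordered pairs $(i,j)\in\{1,\dots,n\}^2$ with $i\ne j$. For $1\le p<\infty$, the $p$-fusion frame potential of the collection of weighted subspaces $\{(V_j,\omega_j)\}_{j=1}^n$ is $$\operatorname{FFP}(\{(V_j,\omega_j)\}_{j=1}^n,p):=\sum_{i,j=1}^n\omega_i\omega_j\langle P_{V_i},P_{V_j}\rangle^p .$$ The family $\{(V_j,\omega_j)\}_{j=1}^n$ is a tight fusion frame if there is a constant $A>0$ such that $\sum_{j=1}^n\omega_j\|P_{V_j}(x)\|^2=A\|x\|^2$ for all $x\in\mathbb{R}^d$. It is equiangular if $\langle P_{V_i},P_{V_j}\rangle$ does not depend on $i\ne j$. An equiangular tight fusion frame is a family that is both equiangular and a tight fusion frame.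
   Formalization: Assumes n ≥ 2; in part 1, if m²/d − Σω_j² dim(V_j) is negative, only odd integer p is covered: for non-integer p its p-th power is undefined, for even p the bound can fail (two orthogonal lines in R³, weights 1, p = 2). *)

theory Defs
  imports "HOL-Analysis.Analysis"
begin

definition Grass :: "(real^'d) set set" where
  "Grass = {V. subspace V \<and> 1 \<le> dim V \<and> dim V \<le> CARD('d) - 1}"

definition orth_proj :: "(real^'d) set \<Rightarrow> real^'d \<Rightarrow> real^'d" where
  "orth_proj V x = (THE y. y \<in> V \<and> (\<forall>z\<in>V. orthogonal (x - y) z))"

definition op_inner :: "(real^'d \<Rightarrow> real^'d) \<Rightarrow> (real^'d \<Rightarrow> real^'d) \<Rightarrow> real" where
  "op_inner P Q = trace (matrix (P \<circ> Q))"

abbreviation proj_inner :: "(real^'d) set \<Rightarrow> (real^'d) set \<Rightarrow> real" where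
  "proj_inner V W \<equiv> op_inner (orth_proj V) (orth_proj W)"

text \<open>A family \<open>(V\<^sub>j, \<omega>\<^sub>j)\<close>, \<open>j = 1, \<dots>, n\<close>, is given by functions on \<open>nat\<close> of which only the values
  on \<open>{1..n}\<close> matter; repeated subspaces are allowed.\<close>

definition offdiag :: "nat \<Rightarrow> (nat \<times> nat) set" where
  "offdiag n = {(i, j). i \<in> {1..n} \<and> j \<in> {1..n} \<and> i \<noteq> j}"

definition FFP :: "nat \<Rightarrow> (nat \<Rightarrow> (real^'d) set) \<Rightarrow> (nat \<Rightarrow> real) \<Rightarrow> real \<Rightarrow> real" where
  "FFP n V \<omega> p = (\<Sum>i=1..n. \<Sum>j=1..n. \<omega> i * \<omega> j * proj_inner (V i) (V j) powr p)"

definition tight_fusion_frame :: "nat \<Rightarrow> (nat \<Rightarrow> (real^'d) set) \<Rightarrow> (nat \<Rightarrow> real) \<Rightarrow> bool" where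
  "tight_fusion_frame n V \<omega> \<longleftrightarrow>
     (\<exists>A>0. \<forall>x. (\<Sum>j=1..n. \<omega> j * (norm (orth_proj (V j) x))\<^sup>2) = A * (norm x)\<^sup>2)"

definition equiangular :: "nat \<Rightarrow> (nat \<Rightarrow> (real^'d) set) \<Rightarrow> bool" where
  "equiangular n V \<longleftrightarrow> (\<exists>c. \<forall>(i, j)\<in>offdiag n. proj_inner (V i) (V j) = c)"

definition equiangular_tight_fusion_frame ::
    "nat \<Rightarrow> (nat \<Rightarrow> (real^'d) set) \<Rightarrow> (nat \<Rightarrow> real) \<Rightarrow> bool" where
  "equiangular_tight_fusion_frame n V \<omega> \<longleftrightarrow> equiangular n V \<and> tight_fusion_frame n V \<omega>"

text \<open>The power \<open>x\<^sup>p\<close> for a base of arbitrary sign. On negative reals the library's \<open>powr\<close> is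
  \<open>\<bar>x\<bar> powr p\<close>, which is not the usual power even for \<open>p = 1\<close>; for \<open>p \<in> \<nat>\<close> we therefore use
  the ordinary integer power. For \<open>p > 0\<close> and \<open>x \<ge> 0\<close> this is just \<open>x powr p\<close>; for \<open>x < 0\<close> and
  \<open>p \<notin> \<nat>\<close> the value has no meaning.\<close>

definition rpow :: "real \<Rightarrow> real \<Rightarrow> real" where
  "rpow x p = (if p \<in> \<nat> then x ^ nat \<lfloor>p\<rfloor> else x powr p)"

end

theory Submission
  imports Defs
begin

text \<open>
  Let \<open>T = \<Sum>\<^sub>j \<omega>\<^sub>j P\<^sub>j\<close> be the fusion frame operator, where \<open>P\<^sub>j\<close> projects onto \<open>V\<^sub>j\<close>. Since
  \<open>trace P\<^sub>j = trace (P\<^sub>j P\<^sub>j) = dim V\<^sub>j\<close>, the trace of \<open>T\<close> is \<open>m\<close>, and the trace of \<open>T\<^sup>2\<close> is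
  \<open>S + \<Sum>\<^sub>j \<omega>\<^sub>j\<^sup>2 dim V\<^sub>j\<close>, where \<open>S\<close> is the sum of \<open>\<omega>\<^sub>i \<omega>\<^sub>j \<langle>P\<^sub>i, P\<^sub>j\<rangle>\<close> over \<open>i \<noteq> j\<close>. With \<open>N\<close> and \<open>W\<close> as in
  the theorem, the squared Frobenius norm of \<open>T - (m / d) I\<close> is therefore exactly \<open>S - N\<close>. This
  proves \<open>S \<ge> N\<close>, with equality iff \<open>T\<close> is a multiple of the identity, that is, iff the
  family is a tight fusion frame (\<open>fusion_frame_defect\<close>, \<open>tight_fusion_frame_iff\<close>). The case
  \<open>p = 1\<close> says nothing more.

  Everything else is an inequality about the nonnegative numbers \<open>x\<^sub>i\<^sub>j = \<langle>P\<^sub>i, P\<^sub>j\<rangle>\<close> with \<open>i \<noteq> j\<close>, whose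
  mean with respect to the weights \<open>\<omega>\<^sub>i \<omega>\<^sub>j\<close> is \<open>S / W \<ge> N / W\<close>. The maximum is at least the mean,
  with equality iff all \<open>x\<^sub>i\<^sub>j\<close> agree. For \<open>p > 1\<close> and \<open>a = N / W \<ge> 0\<close>, averaging the tangent line
  inequality \<open>x\<^sup>p \<ge> a\<^sup>p + p a\<^bsup>p-1\<^esup> (x - a)\<close> bounds the mean of \<open>x\<^sub>i\<^sub>j\<^sup>p\<close> below by \<open>a\<^sup>p\<close>; placing the tangent at
  \<open>N / W\<close> rather than at the true mean makes equality hold only if every \<open>x\<^sub>i\<^sub>j\<close> is \<open>N / W\<close>, so that
  equiangularity and \<open>S = N\<close> come out together. If \<open>N < 0\<close> and \<open>p\<close> is an odd integer, the
  bound is strict because the off-diagonal terms are nonnegative while \<open>N\<^sup>p < 0\<close>; as \<open>S \<ge> 0 > N\<close>,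
  no tight fusion frame exists either.
\<close>

section \<open>Orthogonal projections and their traces\<close>

lemma orth_proj_orthonormal_expansion:
  fixes V :: "(real^'d) set"
  assumes V: "V = span B" and fin: "finite B" and orth: "pairwise orthogonal B"
    and unit: "\<And>u. u \<in> B \<Longrightarrow> norm u = 1"
  shows "orth_proj V = (\<lambda>x. \<Sum>u\<in>B. (x \<bullet> u) *\<^sub>R u)"
proof
  fix x :: "real^'d"
  let ?y = "\<Sum>u\<in>B. (x \<bullet> u) *\<^sub>R u"
  have y: "?y \<in> V"
    unfolding V by (intro span_sum span_scale span_base)
  have "(x - ?y) \<bullet> v = 0" if v: "v \<in> B" for v
  proof -
    have "?y \<bullet> v = (\<Sum>u\<in>B. if u = v then x \<bullet> v else 0)"
      unfolding inner_sum_left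
    proof (rule sum.cong)
      fix u assume u: "u \<in> B"
      show "(x \<bullet> u) *\<^sub>R u \<bullet> v = (if u = v then x \<bullet> v else 0)"
        using unit[OF v] orth u v
        by (auto simp: norm_eq_1 pairwise_def orthogonal_def)
    qed simp
    then show ?thesis
      using fin v by (simp add: inner_diff_left)
  qed
  then have perp: "orthogonal (x - ?y) z" if "z \<in> V" for z
    using that orthogonal_to_span unfolding V orthogonal_def by blast
  show "orth_proj V x = ?y"
    unfolding orth_proj_def
  proof (rule the_equality)
    show "?y \<in> V \<and> (\<forall>z\<in>V. orthogonal (x - ?y) z)"
      using y perp by blast
    fix y' assume y': "y' \<in> V \<and> (\<forall>z\<in>V. orthogonal (x - y') z)"
    then have d: "y' - ?y \<in> V"
      using y unfolding V by (blast intro: span_diff)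
    have "(y' - ?y) \<bullet> (y' - ?y) = (x - ?y) \<bullet> (y' - ?y) - (x - y') \<bullet> (y' - ?y)"
      by (simp add: inner_diff_left)
    also have "\<dots> = 0"
      using perp[OF d] y' d unfolding orthogonal_def by auto
    finally show "y' = ?y" by simp
  qed
qed

lemma subspace_orthonormal_basis:
  fixes V :: "(real^'d) set"
  assumes "subspace V"
  obtains B where "V = span B" "finite B" "card B = dim V" "pairwise orthogonal B"
    "\<And>u. u \<in> B \<Longrightarrow> norm u = 1" "orth_proj V = (\<lambda>x. \<Sum>u\<in>B. (x \<bullet> u) *\<^sub>R u)"
proof -
  obtain B where B: "B \<subseteq> V" "pairwise orthogonal B" "\<And>u. u \<in> B \<Longrightarrow> norm u = 1"
    "independent B" "card B = dim V" "span B = V"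
    using orthonormal_basis_subspace[OF assms] by blast
  then show thesis
    by (intro that[of B] orth_proj_orthonormal_expansion) (auto intro: independent_imp_finite)
qed

lemma linear_orth_proj:
  fixes V :: "(real^'d) set"
  assumes "subspace V"
  shows "linear (orth_proj V)"
proof -
  obtain B where "orth_proj V = (\<lambda>x. \<Sum>u\<in>B. (x \<bullet> u) *\<^sub>R u)"
    using subspace_orthonormal_basis[OF assms] by blast
  then show ?thesis
    by (auto intro!: linearI simp: inner_add_left algebra_simps sum.distrib scaleR_sum_right)
qed

lemma orth_proj_self_adjoint:
  fixes V :: "(real^'d) set"
  assumes "subspace V"
  shows "orth_proj V x \<bullet> y = x \<bullet> orth_proj V y"
proof -
  obtain B where "orth_proj V = (\<lambda>x. \<Sum>u\<in>B. (x \<bullet> u) *\<^sub>R u)"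
    using subspace_orthonormal_basis[OF assms] by blast
  then show ?thesis
    by (simp add: inner_sum_left inner_sum_right inner_commute mult.commute)
qed

lemma orth_proj_inner_self:
  fixes V :: "(real^'d) set"
  assumes "subspace V"
  shows "x \<bullet> orth_proj V x = (norm (orth_proj V x))\<^sup>2"
proof -
  obtain B where B: "V = span B" "finite B" "pairwise orthogonal B"
    "\<And>u. u \<in> B \<Longrightarrow> norm u = 1" "orth_proj V = (\<lambda>x. \<Sum>u\<in>B. (x \<bullet> u) *\<^sub>R u)"
    using subspace_orthonormal_basis[OF assms] by blast
  have "(norm (\<Sum>u\<in>B. (x \<bullet> u) *\<^sub>R u))\<^sup>2 = (\<Sum>u\<in>B. (norm ((x \<bullet> u) *\<^sub>R u))\<^sup>2)"
    using B(2,3) by (intro norm_sum_Pythagorean) (auto simp: pairwise_def orthogonal_def)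
  also have "\<dots> = (\<Sum>u\<in>B. (x \<bullet> u)\<^sup>2)"
    using B(4) by (intro sum.cong) (auto simp: power_mult_distrib)
  finally show ?thesis
    unfolding B(5) by (simp add: inner_sum_right power2_eq_square)
qed

lemma proj_inner_eq_sum_axis:
  fixes V W :: "(real^'d) set"
  assumes "subspace V"
  shows "proj_inner V W = (\<Sum>k\<in>UNIV. orth_proj V (axis k 1) \<bullet> orth_proj W (axis k 1))"
proof -
  have "orth_proj V (orth_proj W (axis k 1)) $ k
      = orth_proj V (axis k 1) \<bullet> orth_proj W (axis k 1)" for k
    using orth_proj_self_adjoint[OF assms, of "axis k 1" "orth_proj W (axis k 1)"]
    by (simp add: inner_axis')
  then show ?thesis
    by (simp add: op_inner_def trace_def matrix_def)
qed

lemma sum_axis_inner_mult: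
  fixes u v :: "real^'d"
  shows "(\<Sum>k\<in>UNIV. (axis k 1 \<bullet> u) * (axis k 1 \<bullet> v)) = u \<bullet> v"
  unfolding inner_axis' by (simp add: inner_vec_def)

text \<open>In orthonormal bases, \<open>trace (P\<^sub>V P\<^sub>W)\<close> is the sum of the squared entries of the cross Gram
  matrix. Both the nonnegativity of the trace and its value for \<open>V = W\<close> are read off from here.\<close>

lemma proj_inner_eq_sum_gram:
  fixes V W :: "(real^'d) set"
  assumes "subspace V"
    and PV: "orth_proj V = (\<lambda>x. \<Sum>u\<in>B. (x \<bullet> u) *\<^sub>R u)"
    and PW: "orth_proj W = (\<lambda>x. \<Sum>v\<in>C. (x \<bullet> v) *\<^sub>R v)"
  shows "proj_inner V W = (\<Sum>u\<in>B. \<Sum>v\<in>C. (u \<bullet> v)\<^sup>2)"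
proof -
  have "proj_inner V W
      = (\<Sum>k\<in>UNIV. \<Sum>u\<in>B. \<Sum>v\<in>C. (u \<bullet> v) * ((axis k 1 \<bullet> u) * (axis k 1 \<bullet> v)))"
    unfolding proj_inner_eq_sum_axis[OF assms(1)] unfolding PV PW inner_sum_left
    unfolding inner_sum_right by (simp add: mult_ac)
  also have "\<dots> = (\<Sum>u\<in>B. \<Sum>v\<in>C. \<Sum>k\<in>UNIV. (u \<bullet> v) * ((axis k 1 \<bullet> u) * (axis k 1 \<bullet> v)))"
    by (subst sum.swap, intro sum.cong refl, rule sum.swap)
  also have "\<dots> = (\<Sum>u\<in>B. \<Sum>v\<in>C. (u \<bullet> v)\<^sup>2)"
    by (simp add: sum_distrib_left[symmetric] sum_axis_inner_mult power2_eq_square)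
  finally show ?thesis .
qed

lemma proj_inner_nonneg:
  fixes V W :: "(real^'d) set"
  assumes "subspace V" "subspace W"
  shows "0 \<le> proj_inner V W"
proof -
  obtain B where B: "orth_proj V = (\<lambda>x. \<Sum>u\<in>B. (x \<bullet> u) *\<^sub>R u)"
    using subspace_orthonormal_basis[OF assms(1)] by blast
  obtain C where C: "orth_proj W = (\<lambda>x. \<Sum>u\<in>C. (x \<bullet> u) *\<^sub>R u)"
    using subspace_orthonormal_basis[OF assms(2)] by blast
  show ?thesis
    unfolding proj_inner_eq_sum_gram[OF assms(1) B C] by (intro sum_nonneg) simp
qed

lemma proj_inner_self:
  fixes V :: "(real^'d) set"
  assumes "subspace V"
  shows "proj_inner V V = real (dim V)"
proof -
  obtain B where B: "finite B" "card B = dim V" "pairwise orthogonal B"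
    "\<And>u. u \<in> B \<Longrightarrow> norm u = 1" "orth_proj V = (\<lambda>x. \<Sum>u\<in>B. (x \<bullet> u) *\<^sub>R u)"
    using subspace_orthonormal_basis[OF assms] by blast
  have "(\<Sum>v\<in>B. (u \<bullet> v)\<^sup>2) = 1" if "u \<in> B" for u
  proof -
    have "(\<Sum>v\<in>B. (u \<bullet> v)\<^sup>2) = (\<Sum>v\<in>B. if v = u then 1 else 0)"
      using that B(3,4) by (intro sum.cong) (auto simp: pairwise_def orthogonal_def norm_eq_1)
    then show ?thesis using that B(1) by simp
  qed
  then show ?thesis
    using B(2) unfolding proj_inner_eq_sum_gram[OF assms B(5) B(5)] by simp
qed

section \<open>The fusion frame operator\<close>

definition fusion_frame_operator ::
    "nat \<Rightarrow> (nat \<Rightarrow> (real^'d) set) \<Rightarrow> (nat \<Rightarrow> real) \<Rightarrow> real^'d \<Rightarrow> real^'d" where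
  "fusion_frame_operator n V \<omega> x = (\<Sum>j=1..n. \<omega> j *\<^sub>R orth_proj (V j) x)"

lemma linear_eq_scaleR_iff_axis:
  fixes T :: "real^'d \<Rightarrow> real^'d"
  assumes "linear T"
  shows "(\<forall>x. T x = c *\<^sub>R x) \<longleftrightarrow> (\<forall>k. T (axis k 1) = c *\<^sub>R axis k 1)"
proof
  assume ax: "\<forall>k. T (axis k 1) = c *\<^sub>R axis k 1"
  have "T = (\<lambda>x. c *\<^sub>R x)"
  proof (rule linear_eq_stdbasis[OF assms])
    show "linear (\<lambda>x::real^'d. c *\<^sub>R x)" by (rule linear_scale_self)
    show "T b = c *\<^sub>R b" if "b \<in> Basis" for b
      using that ax by (auto simp: Basis_vec_def)
  qed
  then show "\<forall>x. T x = c *\<^sub>R x" by simp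
qed simp

text \<open>By polarization, a self-adjoint operator is determined by its quadratic form.\<close>

lemma self_adjoint_eq_scaleR_iff_quadratic_form:
  fixes T :: "'a::real_inner \<Rightarrow> 'a"
  assumes lin: "linear T" and adj: "\<And>x y. T x \<bullet> y = x \<bullet> T y"
  shows "(\<forall>x. T x = c *\<^sub>R x) \<longleftrightarrow> (\<forall>x. x \<bullet> T x = c * (norm x)\<^sup>2)"
proof
  assume q: "\<forall>x. x \<bullet> T x = c * (norm x)\<^sup>2"
  show "\<forall>x. T x = c *\<^sub>R x"
  proof
    fix x
    have pol: "2 * (y \<bullet> T x) = 2 * c * (y \<bullet> x)" for y
    proof -
      have "(x + y) \<bullet> T (x + y) = x \<bullet> T x + y \<bullet> T y + 2 * (y \<bullet> T x)"
        using adj[of x y] adj[of y x]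
        by (simp add: linear_add[OF lin] inner_add_left inner_add_right inner_commute)
      moreover have "(norm (x + y))\<^sup>2 = (norm x)\<^sup>2 + (norm y)\<^sup>2 + 2 * (y \<bullet> x)"
        by (simp add: power2_norm_eq_inner inner_add_left inner_add_right inner_commute)
      ultimately show ?thesis using q by (simp add: algebra_simps)
    qed
    then have "y \<bullet> (T x - c *\<^sub>R x) = 0" for y
      using pol[of y] by (simp add: inner_diff_right)
    then show "T x = c *\<^sub>R x"
      by (metis inner_eq_zero_iff right_minus_eq)
  qed
qed (simp add: power2_norm_eq_inner)

lemma finite_offdiag: "finite (offdiag n)"
  by (rule finite_subset[of _ "{1..n} \<times> {1..n}"]) (auto simp: offdiag_def)

lemma sum_square_eq_offdiag_plus_diag:
  fixes f :: "nat \<Rightarrow> nat \<Rightarrow> real"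
  shows "(\<Sum>i=1..n. \<Sum>j=1..n. f i j) = (\<Sum>(i, j)\<in>offdiag n. f i j) + (\<Sum>j=1..n. f j j)"
proof -
  let ?D = "(\<lambda>j. (j, j)) ` {1..n}"
  have split: "{1..n} \<times> {1..n} = offdiag n \<union> ?D" and disj: "offdiag n \<inter> ?D = {}"
    by (auto simp: offdiag_def)
  have "(\<Sum>i=1..n. \<Sum>j=1..n. f i j) = (\<Sum>(i, j)\<in>offdiag n \<union> ?D. f i j)"
    unfolding split[symmetric] by (rule sum.cartesian_product)
  also have "\<dots> = (\<Sum>(i, j)\<in>offdiag n. f i j) + (\<Sum>(i, j)\<in>?D. f i j)"
    using finite_offdiag disj by (intro sum.union_disjoint) auto
  also have "(\<Sum>(i, j)\<in>?D. f i j) = (\<Sum>j=1..n. f j j)"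
    by (subst sum.reindex) (auto simp: inj_on_def)
  finally show ?thesis .
qed

context
  fixes n :: nat and V :: "nat \<Rightarrow> (real^'d) set" and \<omega> :: "nat \<Rightarrow> real"
  assumes sub: "\<And>j. j \<in> {1..n} \<Longrightarrow> subspace (V j)"
begin

lemma linear_fusion_frame_operator: "linear (fusion_frame_operator n V \<omega>)"
  unfolding fusion_frame_operator_def
  using linear_orth_proj[OF sub]
  by (intro linear_compose_sum ballI linear_compose_scale_right) auto

lemma fusion_frame_operator_self_adjoint:
  "fusion_frame_operator n V \<omega> x \<bullet> y = x \<bullet> fusion_frame_operator n V \<omega> y"
  unfolding fusion_frame_operator_def inner_sum_left inner_sum_right
  using orth_proj_self_adjoint[OF sub] by (intro sum.cong) auto

lemma fusion_frame_operator_quadratic_form: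
  "x \<bullet> fusion_frame_operator n V \<omega> x = (\<Sum>j=1..n. \<omega> j * (norm (orth_proj (V j) x))\<^sup>2)"
  unfolding fusion_frame_operator_def inner_sum_right
  using orth_proj_inner_self[OF sub] by (intro sum.cong) auto

lemma trace_fusion_frame_operator:
  "(\<Sum>k\<in>UNIV. axis k 1 \<bullet> fusion_frame_operator n V \<omega> (axis k 1))
    = (\<Sum>j=1..n. \<omega> j * real (dim (V j)))"
proof -
  have "(\<Sum>k\<in>UNIV. axis k 1 \<bullet> fusion_frame_operator n V \<omega> (axis k 1))
      = (\<Sum>j=1..n. \<omega> j * (\<Sum>k\<in>UNIV. (norm (orth_proj (V j) (axis k 1)))\<^sup>2))"
    unfolding fusion_frame_operator_quadratic_form sum_distrib_left by (rule sum.swap)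
  also have "\<dots> = (\<Sum>j=1..n. \<omega> j * proj_inner (V j) (V j))"
    using proj_inner_eq_sum_axis[OF sub] by (intro sum.cong) (auto simp: power2_norm_eq_inner)
  also have "\<dots> = (\<Sum>j=1..n. \<omega> j * real (dim (V j)))"
    using proj_inner_self[OF sub] by (intro sum.cong) auto
  finally show ?thesis .
qed

lemma trace_fusion_frame_operator_square:
  "(\<Sum>k\<in>UNIV. (norm (fusion_frame_operator n V \<omega> (axis k 1)))\<^sup>2)
    = (\<Sum>(i, j)\<in>offdiag n. \<omega> i * \<omega> j * proj_inner (V i) (V j))
      + (\<Sum>j=1..n. (\<omega> j)\<^sup>2 * real (dim (V j)))"
proof -
  let ?P = "\<lambda>j k. orth_proj (V j) (axis k 1)"
  have "(\<Sum>k\<in>UNIV. (norm (fusion_frame_operator n V \<omega> (axis k 1)))\<^sup>2)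
      = (\<Sum>k\<in>UNIV. \<Sum>i=1..n. \<Sum>j=1..n. \<omega> i * \<omega> j * (?P i k \<bullet> ?P j k))"
    unfolding fusion_frame_operator_def power2_norm_eq_inner inner_sum_left
    unfolding inner_sum_right by (simp add: mult_ac)
  also have "\<dots> = (\<Sum>i=1..n. \<Sum>j=1..n. \<omega> i * \<omega> j * (\<Sum>k\<in>UNIV. ?P i k \<bullet> ?P j k))"
    unfolding sum_distrib_left by (subst sum.swap, intro sum.cong refl, rule sum.swap)
  also have "\<dots> = (\<Sum>i=1..n. \<Sum>j=1..n. \<omega> i * \<omega> j * proj_inner (V i) (V j))"
    using proj_inner_eq_sum_axis[OF sub] by (intro sum.cong refl) auto
  also have "\<dots> = (\<Sum>(i, j)\<in>offdiag n. \<omega> i * \<omega> j * proj_inner (V i) (V j))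
      + (\<Sum>j=1..n. \<omega> j * \<omega> j * proj_inner (V j) (V j))"
    by (rule sum_square_eq_offdiag_plus_diag)
  also have "(\<Sum>j=1..n. \<omega> j * \<omega> j * proj_inner (V j) (V j))
      = (\<Sum>j=1..n. (\<omega> j)\<^sup>2 * real (dim (V j)))"
    using proj_inner_self[OF sub] by (intro sum.cong) (auto simp: power2_eq_square)
  finally show ?thesis .
qed

text \<open>The left-hand side is the squared Frobenius distance of the frame operator from the
  scalar operator of the same trace; expanding the square leaves only the two traces.\<close>

lemma fusion_frame_defect:
  assumes m: "m = (\<Sum>j=1..n. \<omega> j * real (dim (V j)))"
  shows "(\<Sum>k\<in>UNIV. (norm (fusion_frame_operator n V \<omega> (axis k 1)
              - (m / real CARD('d)) *\<^sub>R axis k 1))\<^sup>2)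
    = (\<Sum>(i, j)\<in>offdiag n. \<omega> i * \<omega> j * proj_inner (V i) (V j))
      - (m\<^sup>2 / real CARD('d) - (\<Sum>j=1..n. (\<omega> j)\<^sup>2 * real (dim (V j))))"
proof -
  let ?T = "fusion_frame_operator n V \<omega>" and ?c = "m / real CARD('d)"
  have "(norm (?T (axis k 1) - ?c *\<^sub>R axis k 1))\<^sup>2
      = (norm (?T (axis k 1)))\<^sup>2 - 2 * ?c * (axis k 1 \<bullet> ?T (axis k 1)) + ?c\<^sup>2" for k
  proof -
    have "(axis k 1 :: real^'d) \<bullet> axis k 1 = 1" by (simp add: inner_axis_axis)
    then show ?thesis
      unfolding power2_norm_eq_inner
      by (simp add: inner_diff_left inner_diff_right inner_commute power2_eq_square algebra_simps)
  qed
  then have "(\<Sum>k\<in>UNIV. (norm (?T (axis k 1) - ?c *\<^sub>R axis k 1))\<^sup>2)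
      = (\<Sum>k\<in>UNIV. (norm (?T (axis k 1)))\<^sup>2)
        - 2 * ?c * (\<Sum>k\<in>UNIV. axis k 1 \<bullet> ?T (axis k 1)) + real CARD('d) * ?c\<^sup>2"
    by (simp add: sum.distrib sum_subtractf sum_distrib_left)
  also have "\<dots> = (\<Sum>k\<in>UNIV. (norm (?T (axis k 1)))\<^sup>2) - m\<^sup>2 / real CARD('d)"
    unfolding trace_fusion_frame_operator m[symmetric]
    by (simp add: power2_eq_square field_simps)
  finally show ?thesis
    unfolding trace_fusion_frame_operator_square by simp
qed

corollary offdiag_proj_inner_sum_ge:
  assumes m: "m = (\<Sum>j=1..n. \<omega> j * real (dim (V j)))"
  shows "m\<^sup>2 / real CARD('d) - (\<Sum>j=1..n. (\<omega> j)\<^sup>2 * real (dim (V j)))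
    \<le> (\<Sum>(i, j)\<in>offdiag n. \<omega> i * \<omega> j * proj_inner (V i) (V j))"
proof -
  have "0 \<le> (\<Sum>k\<in>UNIV. (norm (fusion_frame_operator n V \<omega> (axis k 1)
      - (m / real CARD('d)) *\<^sub>R axis k 1))\<^sup>2)"
    by (intro sum_nonneg) simp
  then show ?thesis unfolding fusion_frame_defect[OF m] by linarith
qed

text \<open>The frame constant is forced to be \<open>m / d\<close> by taking traces; positivity of \<open>m\<close> is what
  makes this an admissible constant.\<close>

lemma tight_fusion_frame_iff:
  assumes m: "m = (\<Sum>j=1..n. \<omega> j * real (dim (V j)))" and "0 < m"
  shows "tight_fusion_frame n V \<omega> \<longleftrightarrow>
    (\<Sum>(i, j)\<in>offdiag n. \<omega> i * \<omega> j * proj_inner (V i) (V j))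
      = m\<^sup>2 / real CARD('d) - (\<Sum>j=1..n. (\<omega> j)\<^sup>2 * real (dim (V j)))"
    (is "_ \<longleftrightarrow> ?S = ?N")
proof -
  let ?T = "fusion_frame_operator n V \<omega>" and ?c = "m / real CARD('d)"
  have tight: "tight_fusion_frame n V \<omega> \<longleftrightarrow> (\<exists>A>0. \<forall>x. ?T x = A *\<^sub>R x)"
    unfolding tight_fusion_frame_def fusion_frame_operator_quadratic_form[symmetric]
      self_adjoint_eq_scaleR_iff_quadratic_form
        [OF linear_fusion_frame_operator fusion_frame_operator_self_adjoint] ..
  have "A = ?c" if A: "\<forall>x. ?T x = A *\<^sub>R x" for A
  proof -
    have "m = (\<Sum>k\<in>(UNIV :: 'd set). A)"
      using A unfolding m trace_fusion_frame_operator[symmetric] by (simp add: inner_axis_axis)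
    then show ?thesis by simp
  qed
  moreover have "0 < ?c" using \<open>0 < m\<close> by simp
  ultimately have "tight_fusion_frame n V \<omega> \<longleftrightarrow> (\<forall>x. ?T x = ?c *\<^sub>R x)"
    unfolding tight by metis
  also have "\<dots> \<longleftrightarrow> (\<forall>k. ?T (axis k 1) = ?c *\<^sub>R axis k 1)"
    by (rule linear_eq_scaleR_iff_axis[OF linear_fusion_frame_operator])
  also have "\<dots> \<longleftrightarrow> (\<Sum>k\<in>UNIV. (norm (?T (axis k 1) - ?c *\<^sub>R axis k 1))\<^sup>2) = 0"
    by (subst sum_nonneg_eq_0_iff) auto
  also have "\<dots> \<longleftrightarrow> ?S = ?N"
    unfolding fusion_frame_defect[OF m] by auto
  finally show ?thesis .
qed

lemma FFP_eq_offdiag_plus_diag: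
  "FFP n V \<omega> p = (\<Sum>(i, j)\<in>offdiag n. \<omega> i * \<omega> j * proj_inner (V i) (V j) powr p)
    + (\<Sum>j=1..n. (\<omega> j)\<^sup>2 * real (dim (V j)) powr p)"
proof -
  have "(\<Sum>j=1..n. \<omega> j * \<omega> j * proj_inner (V j) (V j) powr p)
      = (\<Sum>j=1..n. (\<omega> j)\<^sup>2 * real (dim (V j)) powr p)"
    using proj_inner_self[OF sub] by (intro sum.cong) (auto simp: power2_eq_square)
  then show ?thesis
    unfolding FFP_def by (subst sum_square_eq_offdiag_plus_diag) simp
qed

end

section \<open>Weighted means\<close>

text \<open>Bernoulli's inequality in homogeneous form: by strict convexity the graph of \<open>x\<^sup>p\<close>
  lies above its tangent at \<open>a\<close> and touches it only there. At \<open>a = 0\<close> the tangent is the axis.\<close>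

lemma powr_tangent:
  fixes x a p :: real
  assumes p: "1 < p" and x: "0 \<le> x" and a: "0 \<le> a" and "x \<noteq> a"
  shows "a powr p + p * a powr (p - 1) * (x - a) < x powr p"
proof (cases "x = 0 \<or> a = 0")
  case True
  then show ?thesis
  proof
    assume "x = 0"
    moreover from this have "0 < a" using a \<open>x \<noteq> a\<close> by simp
    moreover from this have "p * a powr (p - 1) * a = p * a powr p" by (simp add: powr_diff)
    moreover from \<open>0 < a\<close> have "a powr p < p * a powr p" using p by simp
    ultimately have "a powr p < p * a powr (p - 1) * a" by linarith
    then show ?thesis using \<open>x = 0\<close> by simp
  next
    assume "a = 0"
    then show ?thesis using p x \<open>x \<noteq> a\<close> by simp
  qed
next
  case False
  then have pos: "0 < x" "0 < a" using x a by auto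
  have deriv: "((\<lambda>y. y powr p) has_real_derivative p * y powr (p - 1)) (at y)" if "0 < y" for y
    using that by (rule has_real_derivative_powr)
  consider "a < x" | "x < a" using \<open>x \<noteq> a\<close> by linarith
  then show ?thesis
  proof cases
    case 1
    obtain z where z: "a < z" "x powr p - a powr p = (x - a) * (p * z powr (p - 1))"
      using MVT2[OF 1, of "\<lambda>y. y powr p" "\<lambda>y. p * y powr (p - 1)"] deriv pos by force
    have "(x - a) * (p * a powr (p - 1)) < (x - a) * (p * z powr (p - 1))"
      using 1 p z(1) pos by (simp add: powr_less_mono2)
    then show ?thesis using z(2) by (simp add: mult_ac)
  next
    case 2
    obtain z where z: "x < z" "z < a" "a powr p - x powr p = (a - x) * (p * z powr (p - 1))"
      using MVT2[OF 2, of "\<lambda>y. y powr p" "\<lambda>y. p * y powr (p - 1)"] deriv pos by force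
    have "(a - x) * (p * z powr (p - 1)) < (a - x) * (p * a powr (p - 1))"
      using 2 p z(1,2) pos by (simp add: powr_less_mono2)
    then show ?thesis using z(3) by (simp add: algebra_simps)
  qed
qed

text \<open>A power mean bound in which \<open>a\<close> need only lie below the mean of \<open>x\<close>: if equality holds,
  both losses vanish, so that \<open>x\<close> is constant with value \<open>a\<close>.\<close>

lemma sum_powr_ge:
  fixes w x :: "'a \<Rightarrow> real"
  assumes fin: "finite I" and w: "\<And>i. i \<in> I \<Longrightarrow> 0 < w i" and x: "\<And>i. i \<in> I \<Longrightarrow> 0 \<le> x i"
    and p: "1 < p" and a: "0 \<le> a" and mean: "a * sum w I \<le> (\<Sum>i\<in>I. w i * x i)"
  shows "a powr p * sum w I \<le> (\<Sum>i\<in>I. w i * x i powr p)"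
    and "(\<Sum>i\<in>I. w i * x i powr p) = a powr p * sum w I \<longleftrightarrow> (\<forall>i\<in>I. x i = a)"
proof -
  define q where "q = p * a powr (p - 1)"
  have q: "0 \<le> q" using p by (simp add: q_def)
  \<comment> \<open>the nonnegative gap between the power and its tangent at \<open>a\<close>\<close>
  define g where "g i = x i powr p - (a powr p + q * (x i - a))" for i
  have g: "0 \<le> g i" if "i \<in> I" for i
    using powr_tangent[OF p x[OF that] a] by (cases "x i = a") (auto simp: g_def q_def)
  have g0: "x i = a" if "i \<in> I" "g i = 0" for i
    using powr_tangent[OF p x[OF that(1)] a] that(2) by (auto simp: g_def q_def)
  have eq: "(\<Sum>i\<in>I. w i * x i powr p)
      = a powr p * sum w I + q * ((\<Sum>i\<in>I. w i * x i) - a * sum w I) + (\<Sum>i\<in>I. w i * g i)"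
    by (simp add: g_def sum_distrib_left sum.distrib[symmetric] sum_subtractf[symmetric])
       (intro sum.cong refl, simp add: algebra_simps)
  have t: "0 \<le> q * ((\<Sum>i\<in>I. w i * x i) - a * sum w I)"
    using q mean by simp
  have wg: "0 \<le> w i * g i" if "i \<in> I" for i
    using w[OF that] g[OF that] by simp
  have s: "0 \<le> (\<Sum>i\<in>I. w i * g i)" by (intro sum_nonneg wg)
  show "a powr p * sum w I \<le> (\<Sum>i\<in>I. w i * x i powr p)"
    using eq t s by linarith
  show "(\<Sum>i\<in>I. w i * x i powr p) = a powr p * sum w I \<longleftrightarrow> (\<forall>i\<in>I. x i = a)"
  proof
    assume "(\<Sum>i\<in>I. w i * x i powr p) = a powr p * sum w I"
    then have "(\<Sum>i\<in>I. w i * g i) = 0" using eq t s by linarith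
    then have "\<forall>i\<in>I. w i * g i = 0" using sum_nonneg_eq_0_iff[OF fin, of "\<lambda>i. w i * g i"] wg by blast
    then show "\<forall>i\<in>I. x i = a" using g0 w by (metis less_irrefl mult_eq_0_iff)
  next
    assume "\<forall>i\<in>I. x i = a"
    then show "(\<Sum>i\<in>I. w i * x i powr p) = a powr p * sum w I"
      by (simp add: sum_distrib_right[symmetric] mult.commute)
  qed
qed

lemma Max_ge_weighted_mean:
  fixes w x :: "'a \<Rightarrow> real"
  assumes fin: "finite I" and w: "\<And>i. i \<in> I \<Longrightarrow> 0 < w i"
  shows "(\<Sum>i\<in>I. w i * x i) \<le> Max (x ` I) * sum w I"
    and "(\<Sum>i\<in>I. w i * x i) = Max (x ` I) * sum w I \<longleftrightarrow> (\<forall>i\<in>I. x i = Max (x ` I))"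
proof -
  let ?M = "Max (x ` I)"
  have gap: "?M * sum w I - (\<Sum>i\<in>I. w i * x i) = (\<Sum>i\<in>I. w i * (?M - x i))"
    by (simp add: sum_subtractf right_diff_distrib sum_distrib_right[symmetric] mult.commute)
  have nn: "0 \<le> w i * (?M - x i)" if "i \<in> I" for i
    using fin that w[OF that] by simp
  show "(\<Sum>i\<in>I. w i * x i) \<le> ?M * sum w I"
    using gap sum_nonneg[of I "\<lambda>i. w i * (?M - x i)", OF nn] by simp
  have "(\<Sum>i\<in>I. w i * x i) = ?M * sum w I \<longleftrightarrow> (\<Sum>i\<in>I. w i * (?M - x i)) = 0"
    using gap by auto
  also have "\<dots> \<longleftrightarrow> (\<forall>i\<in>I. w i * (?M - x i) = 0)"
    using sum_nonneg_eq_0_iff[OF fin, of "\<lambda>i. w i * (?M - x i)"] nn by blast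
  also have "\<dots> \<longleftrightarrow> (\<forall>i\<in>I. x i = ?M)"
    using w by (metis less_irrefl mult_eq_0_iff right_minus_eq)
  finally show "(\<Sum>i\<in>I. w i * x i) = ?M * sum w I \<longleftrightarrow> (\<forall>i\<in>I. x i = ?M)" .
qed

lemma rpow_nonneg_base:
  assumes "0 \<le> x" "0 < p"
  shows "rpow x p = x powr p"
proof (cases "p \<in> \<nat>")
  case True
  then obtain k where k: "p = real k" by (auto simp: Nats_def)
  then show ?thesis
    using assms by (cases "x = 0") (auto simp: rpow_def powr_realpow)
qed (simp add: rpow_def)

section \<open>Lower bounds for the potential and the largest pairwise trace\<close>

theorem theorem3p4:
  fixes n :: nat
    and V :: "nat \<Rightarrow> (real^'d) set"
    and \<omega> :: "nat \<Rightarrow> real"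
    and m :: real
  assumes "2 \<le> n"
    and "\<And>j. j \<in> {1..n} \<Longrightarrow> 0 < \<omega> j"
    and "\<And>j. j \<in> {1..n} \<Longrightarrow> V j \<in> Grass"
    and "m = (\<Sum>j=1..n. \<omega> j * real (dim (V j)))"
  shows "let N = m\<^sup>2 / real CARD('d) - (\<Sum>j=1..n. (\<omega> j)\<^sup>2 * real (dim (V j)));
             W = (\<Sum>(i, j)\<in>offdiag n. \<omega> i * \<omega> j);
             B = (\<lambda>p. rpow N p / W powr (p - 1)
                      + (\<Sum>j=1..n. (\<omega> j)\<^sup>2 * real (dim (V j)) powr p));
             M = Max ((\<lambda>(i, j). proj_inner (V i) (V j)) ` offdiag n)
         in (\<forall>p\<ge>1. 0 \<le> N \<or> (\<exists>k::nat. p = real (2 * k + 1)) \<longrightarrow>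
                FFP n V \<omega> p \<ge> B p
              \<and> (p = 1 \<longrightarrow> (FFP n V \<omega> p = B p \<longleftrightarrow> tight_fusion_frame n V \<omega>))
              \<and> (1 < p \<longrightarrow> (FFP n V \<omega> p = B p \<longleftrightarrow> equiangular_tight_fusion_frame n V \<omega>)))
          \<and> M \<ge> N / W
          \<and> (M = N / W \<longleftrightarrow> equiangular_tight_fusion_frame n V \<omega>)"
proof -
  define N where "N = m\<^sup>2 / real CARD('d) - (\<Sum>j=1..n. (\<omega> j)\<^sup>2 * real (dim (V j)))"
  let ?I = "offdiag n"
  define w :: "nat \<times> nat \<Rightarrow> real" where "w = (\<lambda>(i, j). \<omega> i * \<omega> j)"
  define x where "x = (\<lambda>(i, j). proj_inner (V i) (V j))"
  let ?W = "sum w ?I" and ?S = "\<Sum>e\<in>?I. w e * x e" and ?M = "Max (x ` ?I)"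
  define D where "D = (\<lambda>p. \<Sum>j=1..n. (\<omega> j)\<^sup>2 * real (dim (V j)) powr p)"
  define B where "B = (\<lambda>p. rpow N p / ?W powr (p - 1) + D p)"
  have sub: "subspace (V j)" and dim: "1 \<le> dim (V j)" if "j \<in> {1..n}" for j
    using assms(3)[OF that] by (auto simp: Grass_def)
  have fin: "finite ?I" by (rule finite_offdiag)
  have w: "0 < w e" and x: "0 \<le> x e" if "e \<in> ?I" for e
    using that assms(2) proj_inner_nonneg sub by (auto simp: offdiag_def w_def x_def)
  have ne: "(1, 2) \<in> ?I" using assms(1) by (auto simp: offdiag_def)
  have W: "0 < ?W"
    using fin w ne by (intro sum_pos) auto
  have "0 < m"
    unfolding assms(4) using assms(1,2) dim by (intro sum_pos) (auto intro!: mult_pos_pos simp: Suc_le_eq)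
  have S_eq: "?S = (\<Sum>(i, j)\<in>?I. \<omega> i * \<omega> j * proj_inner (V i) (V j))"
    by (simp add: w_def x_def case_prod_unfold)
  have NS: "N \<le> ?S"
    unfolding S_eq N_def using sub assms(4) by (rule offdiag_proj_inner_sum_ge)
  have tight: "tight_fusion_frame n V \<omega> \<longleftrightarrow> ?S = N"
    unfolding S_eq N_def using sub assms(4) \<open>0 < m\<close> by (rule tight_fusion_frame_iff)
  have equi: "equiangular n V \<longleftrightarrow> (\<exists>c. \<forall>e\<in>?I. x e = c)"
    by (simp add: equiangular_def x_def case_prod_unfold)
  have etff: "equiangular_tight_fusion_frame n V \<omega> \<longleftrightarrow> (\<forall>e\<in>?I. x e = N / ?W)"
  proof
    assume "equiangular_tight_fusion_frame n V \<omega>"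
    then obtain c where c: "\<forall>e\<in>?I. x e = c" and "?S = N"
      using tight equi unfolding equiangular_tight_fusion_frame_def by blast
    moreover from c have "?S = ?W * c" by (simp add: sum_distrib_right)
    ultimately show "\<forall>e\<in>?I. x e = N / ?W" using c W by simp
  next
    assume c: "\<forall>e\<in>?I. x e = N / ?W"
    then have "?S = (\<Sum>e\<in>?I. w e * (N / ?W))" by simp
    also have "\<dots> = ?W * (N / ?W)" by (rule sum_distrib_right[symmetric])
    finally have "?S = N" using W by simp
    then have "tight_fusion_frame n V \<omega>" using tight by simp
    then show "equiangular_tight_fusion_frame n V \<omega>"
      using c equi unfolding equiangular_tight_fusion_frame_def by blast
  qed
  have FFP: "FFP n V \<omega> p = (\<Sum>e\<in>?I. w e * x e powr p) + D p" for p
    using FFP_eq_offdiag_plus_diag[of n V \<omega> p] sub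
    by (simp add: w_def x_def D_def case_prod_unfold)

  have part1: "FFP n V \<omega> p \<ge> B p
      \<and> (p = 1 \<longrightarrow> (FFP n V \<omega> p = B p \<longleftrightarrow> tight_fusion_frame n V \<omega>))
      \<and> (1 < p \<longrightarrow> (FFP n V \<omega> p = B p \<longleftrightarrow> equiangular_tight_fusion_frame n V \<omega>))"
    if p: "1 \<le> p" and dom: "0 \<le> N \<or> (\<exists>k::nat. p = real (2 * k + 1))" for p
  proof -
    consider "p = 1" | "1 < p" "0 \<le> N" | "1 < p" "N < 0"
      using p by linarith
    then show ?thesis
    proof cases
      case 1
      have "(\<Sum>e\<in>?I. w e * x e powr 1) = ?S"
        using x by (intro sum.cong) auto
      moreover have "B 1 = N + D 1" using W by (simp add: B_def rpow_def)
      ultimately show ?thesis using 1 NS tight FFP[of 1] by auto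
    next
      case 2
      have "rpow N p / ?W powr (p - 1) = (N / ?W) powr p * ?W"
        using 2 W by (simp add: rpow_nonneg_base powr_divide powr_diff)
      then have B: "B p = (N / ?W) powr p * ?W + D p" by (simp add: B_def)
      have a: "0 \<le> N / ?W" and mean: "N / ?W * ?W \<le> ?S"
        using 2 W NS by auto
      show ?thesis
        using sum_powr_ge[where I = ?I and w = w and x = x and p = p and a = "N / ?W",
            OF fin w x 2(1) a mean] 2 etff FFP[of p] B by auto
    next
      \<comment> \<open>for odd \<open>p\<close> the off-diagonal bound is negative, hence never attained by nonnegative terms\<close>
      case 3
      then obtain k :: nat where k: "p = real (2 * k + 1)" using dom by auto
      then have "rpow N p = N ^ (2 * k + 1)"
        unfolding rpow_def by (simp only: of_nat_in_Nats if_True floor_of_nat nat_int)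
      then have "rpow N p < 0" using 3 power_less_zero_eq[of N "2 * k + 1"] by simp
      then have "rpow N p / ?W powr (p - 1) < 0" using W by (simp add: divide_neg_pos)
      moreover have "0 \<le> (\<Sum>e\<in>?I. w e * x e powr p)"
        using w by (intro sum_nonneg mult_nonneg_nonneg) (auto intro: less_imp_le)
      ultimately have "B p < FFP n V \<omega> p" using FFP[of p] by (simp add: B_def)
      moreover have "\<not> equiangular_tight_fusion_frame n V \<omega>"
        using etff x[OF ne] ne 3 W by (metis divide_neg_pos not_less)
      ultimately show ?thesis using 3 by auto
    qed
  qed

  have max: "?S \<le> ?M * ?W" "?S = ?M * ?W \<longleftrightarrow> (\<forall>e\<in>?I. x e = ?M)"
    using Max_ge_weighted_mean[where I = ?I and w = w and x = x, OF fin w] by auto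
  have M_ge: "N / ?W \<le> ?M"
    using NS max(1) W by (simp add: pos_divide_le_eq)
  have M_eq: "?M = N / ?W \<longleftrightarrow> equiangular_tight_fusion_frame n V \<omega>"
  proof
    assume M: "?M = N / ?W"
    then have "?M * ?W = N" using W by simp
    then have "?S = ?M * ?W" using NS max(1) by linarith
    then show "equiangular_tight_fusion_frame n V \<omega>"
      unfolding etff using max(2) M by simp
  next
    assume "equiangular_tight_fusion_frame n V \<omega>"
    then have "x ` ?I = {N / ?W}" unfolding etff using ne by force
    then show "?M = N / ?W" by simp
  qed
  show ?thesis
    using part1 M_ge M_eq
    unfolding Let_def B_def D_def N_def x_def w_def by blast
qed

end
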